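(* Let $D$ and $Q$ be groups with $D\neq\{1\}$, let $\Omega$ be a $Q$-set, and let $G=D\wr_\Omega Q$ be the corresponding wreath product. A necessary and sufficient condition for $G$ to be icc is that, on the one hand, condition (i) is satisfied: (i) $1$ is the only element of $FC(Q)$ which fixes $\Omega$ pointwise; and, on the other hand, at least one of the following conditions is satisfied: (ii) $D$ is icc; (iii) all $Q$-orbits in $\Omega$ are infinite. In particular, if the action of $Q$ on $\Omega$ is free, then $G$ is icc if and only if either $D$ is icc or $Q$ is infinite.
   Context: A group is said to be icc (with infinite conjugacy classes) if it is non-trivial and all its conjugacy classes except $\{1\}$ are infinite. For a group $H$, $FC(H)$ denotes the set of elements of $H$ having a finite conjugacy class in $H$; it is a normal subgroup of $H$. A $Q$-set is a set with a left action of $Q$. Given groups $D$, $Q$ and a $Q$-set $\Omega$, let $D^{(\Omega)}$ be the group (under pointwise multiplication) of maps $\phi:\Omega\to D$ with finite support, i.e. $\phi(x)=1$ for all but finitely many $x\in\Omega$. Let $\lambda:Q\to \mathrm{Aut}(D^{(\Omega)})$ be the homomorphism defined by $\lambda(q)(\phi)(x)=\phi(q^{-1}x)$ for all $q\in Q$, $\phi\in D^{(\Omega)}$, $x\in\Omega$. The wreath product $D\wr_\Omega Q$ is the split extension (semidirect product) $D^{(\Omega)}\rtimes Q$ associated with $\lambda$, in the sense that $q\phi q^{-1}=\lambda(q)(\phi)$ for all $\phi\in D^{(\Omega)}$, $q\in Q$. The action of $Q$ on $\Omega$ is free if $qx=x$ for some $x\in\Omega$ implies $q=1$.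
   Formalization: The case of empty Ω with trivial Q is excluded from the equivalence (there G = 1 is not icc, yet (i) and (iii) hold), and Ω is assumed non-empty in the free-action part (for empty Ω, G = Q, and Q = ℤ is a counterexample). *)

theory Defs
  imports "HOL-Algebra.Group_Action" "HOL-Algebra.Product_Groups"
begin

definition conjugacy_class :: "('a, 'b) monoid_scheme \<Rightarrow> 'a \<Rightarrow> 'a set" where
  "conjugacy_class G x = {g \<otimes>\<^bsub>G\<^esub> x \<otimes>\<^bsub>G\<^esub> inv\<^bsub>G\<^esub> g | g. g \<in> carrier G}"

definition icc :: "('a, 'b) monoid_scheme \<Rightarrow> bool" where
  "icc G \<longleftrightarrow> carrier G \<noteq> {\<one>\<^bsub>G\<^esub>} \<and>
     (\<forall>C \<in> conjugacy_class G ` carrier G. C \<noteq> {\<one>\<^bsub>G\<^esub>} \<longrightarrow> infinite C)"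

definition FC :: "('a, 'b) monoid_scheme \<Rightarrow> 'a set" where
  "FC H = {x \<in> carrier H. finite (conjugacy_class H x)}"

definition semidirect_product ::
  "('n, 'a) monoid_scheme \<Rightarrow> ('q, 'b) monoid_scheme \<Rightarrow> ('q \<Rightarrow> 'n \<Rightarrow> 'n) \<Rightarrow> ('n \<times> 'q) monoid" where
  "semidirect_product N Q \<alpha> =
    \<lparr>carrier = carrier N \<times> carrier Q,
     monoid.mult = (\<lambda>(n, q) (n', q'). (n \<otimes>\<^bsub>N\<^esub> \<alpha> q n', q \<otimes>\<^bsub>Q\<^esub> q')),
     one = (\<one>\<^bsub>N\<^esub>, \<one>\<^bsub>Q\<^esub>)\<rparr>"

text \<open>
  The restricted power of \<open>D\<close> over \<open>\<Omega>\<close> (finitely supported maps from \<open>\<Omega>\<close> to \<open>D\<close>) is the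
  direct sum of copies of \<open>D\<close>; maps are extended by \<open>undefined\<close> outside \<open>\<Omega>\<close>.
\<close>

abbreviation restricted_power :: "('d, 'a) monoid_scheme \<Rightarrow> 'x set \<Rightarrow> ('x \<Rightarrow> 'd) monoid" where
  "restricted_power D \<Omega> \<equiv> sum_group \<Omega> (\<lambda>_. D)"

lemma carrier_restricted_power:
  assumes "group D"
  shows "carrier (restricted_power D \<Omega>) =
    {\<phi> \<in> \<Omega> \<rightarrow>\<^sub>E carrier D. finite {x \<in> \<Omega>. \<phi> x \<noteq> \<one>\<^bsub>D\<^esub>}}"
  using assms by (simp add: carrier_sum_group)

definition shift ::
  "('d, 'a) monoid_scheme \<Rightarrow> ('q, 'b) monoid_scheme \<Rightarrow> 'x set \<Rightarrow> ('q \<Rightarrow> 'x \<Rightarrow> 'x)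
    \<Rightarrow> 'q \<Rightarrow> ('x \<Rightarrow> 'd) \<Rightarrow> ('x \<Rightarrow> 'd)" where
  "shift D Q \<Omega> act q =
    (\<lambda>\<phi> \<in> carrier (restricted_power D \<Omega>). \<lambda>x \<in> \<Omega>. \<phi> (act (inv\<^bsub>Q\<^esub> q) x))"

definition wreath_product ::
  "('d, 'a) monoid_scheme \<Rightarrow> ('q, 'b) monoid_scheme \<Rightarrow> 'x set \<Rightarrow> ('q \<Rightarrow> 'x \<Rightarrow> 'x)
    \<Rightarrow> (('x \<Rightarrow> 'd) \<times> 'q) monoid" where
  "wreath_product D Q \<Omega> act = semidirect_product (restricted_power D \<Omega>) Q (shift D Q \<Omega> act)"

definition free_action :: "('q, 'b) monoid_scheme \<Rightarrow> 'x set \<Rightarrow> ('q \<Rightarrow> 'x \<Rightarrow> 'x) \<Rightarrow> bool" where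
  "free_action Q \<Omega> act \<longleftrightarrow>
     (\<forall>q \<in> carrier Q. \<forall>x \<in> \<Omega>. act q x = x \<longrightarrow> q = \<one>\<^bsub>Q\<^esub>)"

lemma group_semidirect_product:
  assumes N: "group N" and Q: "group Q" and \<alpha>: "\<alpha> \<in> hom Q (AutoGroup N)"
  shows "group (semidirect_product N Q \<alpha>)"
proof -
  interpret N: group N by fact
  interpret Q: group Q by fact
  interpret A: group "AutoGroup N" by (rule N.AutoGroup)
  interpret h: group_hom Q "AutoGroup N" \<alpha> by unfold_locales (rule \<alpha>)
  have aut: "\<alpha> q \<in> auto N" if "q \<in> carrier Q" for q
    using h.hom_closed[OF that] by (simp add: AutoGroup_def)
  have cl: "\<alpha> q n \<in> carrier N" if "q \<in> carrier Q" "n \<in> carrier N" for q n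
    using aut[OF that(1)] that(2) by (auto simp: auto_def hom_def)
  have mul: "\<alpha> q (n \<otimes>\<^bsub>N\<^esub> m) = \<alpha> q n \<otimes>\<^bsub>N\<^esub> \<alpha> q m"
    if "q \<in> carrier Q" "n \<in> carrier N" "m \<in> carrier N" for q n m
    using aut[OF that(1)] that(2,3) by (auto simp: auto_def hom_def)
  have one: "\<alpha> \<one>\<^bsub>Q\<^esub> n = n" if "n \<in> carrier N" for n
    using h.hom_one that by (simp add: AutoGroup_def BijGroup_def)
  have comp: "\<alpha> (p \<otimes>\<^bsub>Q\<^esub> q) n = \<alpha> p (\<alpha> q n)"
    if "p \<in> carrier Q" "q \<in> carrier Q" "n \<in> carrier N" for p q n
    using h.hom_mult[OF that(1,2)] aut[OF that(1)] aut[OF that(2)] that(3)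
    by (simp add: AutoGroup_def BijGroup_def auto_def compose_def)
  show ?thesis
  proof (rule groupI)
    fix x assume "x \<in> carrier (semidirect_product N Q \<alpha>)"
    then obtain n q where x: "x = (n, q)" "n \<in> carrier N" "q \<in> carrier Q"
      by (auto simp: semidirect_product_def)
    let ?y = "(\<alpha> (inv\<^bsub>Q\<^esub> q) (inv\<^bsub>N\<^esub> n), inv\<^bsub>Q\<^esub> q)"
    have "\<alpha> (inv\<^bsub>Q\<^esub> q) (inv\<^bsub>N\<^esub> n) \<otimes>\<^bsub>N\<^esub> \<alpha> (inv\<^bsub>Q\<^esub> q) n = \<alpha> (inv\<^bsub>Q\<^esub> q) \<one>\<^bsub>N\<^esub>"
      using x mul[of "inv\<^bsub>Q\<^esub> q" "inv\<^bsub>N\<^esub> n" n] by (simp del: h.hom_inv)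
    also have "\<dots> = \<one>\<^bsub>N\<^esub>"
      using cl[of "inv\<^bsub>Q\<^esub> q" "\<one>\<^bsub>N\<^esub>"] mul[of "inv\<^bsub>Q\<^esub> q" "\<one>\<^bsub>N\<^esub>" "\<one>\<^bsub>N\<^esub>"] x
      by (simp del: h.hom_inv)
    finally show "\<exists>y\<in>carrier (semidirect_product N Q \<alpha>).
        y \<otimes>\<^bsub>semidirect_product N Q \<alpha>\<^esub> x = \<one>\<^bsub>semidirect_product N Q \<alpha>\<^esub>"
      using x by (intro bexI[of _ ?y]) (auto simp: semidirect_product_def cl simp del: h.hom_inv)
  qed (auto simp: semidirect_product_def cl mul one comp N.m_assoc Q.m_assoc
      simp del: h.hom_mult h.hom_one)
qed

lemma shift_hom:
  assumes D: "group D" and act: "group_action Q \<Omega> act"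
  shows "shift D Q \<Omega> act \<in> hom Q (AutoGroup (restricted_power D \<Omega>))"
proof -
  interpret D: group D by fact
  interpret a: group_action Q \<Omega> act by fact
  interpret Q: group Q using a.group_hom by (simp add: group_hom_def)
  let ?N = "restricted_power D \<Omega>" and ?s = "shift D Q \<Omega> act"
  have cN: "carrier ?N = {\<phi> \<in> \<Omega> \<rightarrow>\<^sub>E carrier D. finite {x \<in> \<Omega>. \<phi> x \<noteq> \<one>\<^bsub>D\<^esub>}}"
    by (rule carrier_restricted_power[OF D])
  have im: "act q x \<in> \<Omega>" if "q \<in> carrier Q" "x \<in> \<Omega>" for q x
    using that a.element_image by blast
  have cl: "?s q \<phi> \<in> carrier ?N" if q: "q \<in> carrier Q" and \<phi>: "\<phi> \<in> carrier ?N" for q \<phi>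
  proof -
    have "finite (act (inv\<^bsub>Q\<^esub> q) -` {x \<in> \<Omega>. \<phi> x \<noteq> \<one>\<^bsub>D\<^esub>} \<inter> \<Omega>)"
      using \<phi> q a.inj_prop by (intro finite_vimage_IntI) (auto simp: cN)
    then have "finite {x \<in> \<Omega>. ?s q \<phi> x \<noteq> \<one>\<^bsub>D\<^esub>}"
      by (rule rev_finite_subset) (use \<phi> q im in \<open>auto simp: shift_def\<close>)
    then show ?thesis
      using \<phi> q im by (auto simp: cN shift_def PiE_iff)
  qed
  have comp: "?s (p \<otimes>\<^bsub>Q\<^esub> q) \<phi> = ?s p (?s q \<phi>)"
    if p: "p \<in> carrier Q" and q: "q \<in> carrier Q" and \<phi>: "\<phi> \<in> carrier ?N" for p q \<phi>
  proof
    fix x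
    show "?s (p \<otimes>\<^bsub>Q\<^esub> q) \<phi> x = ?s p (?s q \<phi>) x"
      using p q \<phi> im cl[OF q \<phi>]
      by (cases "x \<in> \<Omega>") (simp_all add: shift_def Q.inv_mult_group a.composition_rule)
  qed
  have one: "?s \<one>\<^bsub>Q\<^esub> \<phi> = \<phi>" if "\<phi> \<in> carrier ?N" for \<phi>
  proof
    fix x
    have "act \<one>\<^bsub>Q\<^esub> x = x" if "x \<in> \<Omega>"
      using that a.id_eq_one by (metis restrict_apply')
    then show "?s \<one>\<^bsub>Q\<^esub> \<phi> x = \<phi> x"
      using that by (cases "x \<in> \<Omega>") (auto simp: shift_def cN PiE_iff extensional_def)
  qed
  have bij: "bij_betw (?s q) (carrier ?N) (carrier ?N)" if q: "q \<in> carrier Q" for q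
  proof (rule bij_betw_byWitness[where f' = "?s (inv\<^bsub>Q\<^esub> q)"])
    show "\<forall>\<phi>\<in>carrier ?N. ?s (inv\<^bsub>Q\<^esub> q) (?s q \<phi>) = \<phi>"
      using q comp[of "inv\<^bsub>Q\<^esub> q" q] one by simp
    show "\<forall>\<phi>\<in>carrier ?N. ?s q (?s (inv\<^bsub>Q\<^esub> q) \<phi>) = \<phi>"
      using q comp[of q "inv\<^bsub>Q\<^esub> q"] one by simp
  qed (use q cl in auto)
  have N: "group ?N" using D by simp
  have mul: "?s q (\<phi> \<otimes>\<^bsub>?N\<^esub> \<psi>) = ?s q \<phi> \<otimes>\<^bsub>?N\<^esub> ?s q \<psi>"
    if "q \<in> carrier Q" "\<phi> \<in> carrier ?N" "\<psi> \<in> carrier ?N" for q \<phi> \<psi>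
  proof -
    have "\<phi> \<otimes>\<^bsub>?N\<^esub> \<psi> \<in> carrier ?N"
      using that N by (simp add: group.is_monoid monoid.m_closed del: mult_sum_group)
    then show ?thesis
      using that im by (auto simp: shift_def fun_eq_iff)
  qed
  have aut: "?s q \<in> auto ?N" if q: "q \<in> carrier Q" for q
    using q bij[OF q] cl[OF q] mul[OF q]
    by (auto simp: auto_def hom_def Bij_def shift_def simp del: mult_sum_group)
  show ?thesis
  proof (rule homI)
    fix p q assume p: "p \<in> carrier Q" and q: "q \<in> carrier Q"
    show "?s (p \<otimes>\<^bsub>Q\<^esub> q) = ?s p \<otimes>\<^bsub>AutoGroup ?N\<^esub> ?s q"
    proof (rule extensionalityI[where A = "carrier ?N"])
      show "?s (p \<otimes>\<^bsub>Q\<^esub> q) \<in> extensional (carrier ?N)"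
        by (simp add: shift_def)
      show "?s p \<otimes>\<^bsub>AutoGroup ?N\<^esub> ?s q \<in> extensional (carrier ?N)"
        using aut[OF p] aut[OF q] by (simp add: AutoGroup_def BijGroup_def auto_def)
    qed (use aut[OF p] aut[OF q] p q comp in
        \<open>simp add: AutoGroup_def BijGroup_def auto_def compose_eq\<close>)
  qed (use aut in \<open>simp add: AutoGroup_def\<close>)
qed

lemma group_wreath_product:
  assumes "group D" "group_action Q \<Omega> act"
  shows "group (wreath_product D Q \<Omega> act)"
proof -
  have "group Q" using assms(2) by (simp add: group_action_def group_hom_def)
  then show ?thesis
    unfolding wreath_product_def
    using assms by (intro group_semidirect_product shift_hom) simp_all
qed

end

theory Submission
  imports Defs
begin

text \<open>
  A non-trivial group is icc exactly when its FC-centre is trivial, so the task is to decide when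
  the wreath product \<open>W\<close> has an element \<open>(\<phi>, q) \<noteq> 1\<close> with only finitely many conjugates.
  Everything is read off from one formula (\<open>conj_W\<close>): conjugating \<open>(\<phi>, q)\<close> by \<open>(\<psi>, p)\<close> yields
  \<open>(\<phi>', r)\<close> with \<open>r = p q p\<inverse>\<close> and \<open>\<phi>' x = \<psi> x \<cdot> \<phi> (p\<inverse> x) \<cdot> (\<psi> (r\<inverse> x))\<inverse>\<close>.

  Necessity is by exhibiting such elements. An element \<open>q\<close> of \<open>FC Q\<close> fixing \<open>\<Omega>\<close> pointwise commutes
  with the base group, so \<open>(1, q)\<close> has no more conjugates than \<open>q\<close> (\<open>pointwise_fixing_FC\<close>). If
  \<open>D\<close> is not icc and some orbit is finite, the function that is constant on this orbit, with value a
  non-trivial element of \<open>FC D\<close>, and trivial elsewhere, is \<open>Q\<close>-invariant; its conjugates differ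
  from it only by conjugating its finitely many values (\<open>constant_on_finite_orbit_FC\<close>).

  For sufficiency let \<open>(\<phi>, q)\<close> have a finite class. Then so does \<open>q\<close> in \<open>Q\<close>, and by condition (i) it
  remains to see, for each \<open>x\<close>, that \<open>q\<close> fixes \<open>x\<close> and \<open>\<phi> x = 1\<close>. Conjugation by functions
  supported at \<open>x\<close> replaces the value \<open>\<phi> x\<close> by \<open>d \<cdot> \<phi> x\<close> if \<open>q\<close> moves \<open>x\<close>, and by
  \<open>d \<cdot> \<phi> x \<cdot> d\<inverse>\<close> otherwise (\<open>conj_by_bump\<close>). If \<open>D\<close> is icc, then \<open>D\<close> is infinite and the first
  alternative would give infinitely many conjugates, while the second one puts \<open>\<phi> x\<close> into \<open>FC D\<close>.
  If the orbits are infinite, the union of the supports over the class of \<open>(\<phi>, q)\<close> is a finite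
  \<open>Q\<close>-invariant set, hence empty; every conjugate thus lies in \<open>Q\<close>, and the first alternative with
  \<open>d \<noteq> 1\<close> would give one that does not (\<open>FC_W_fixes_infinite_orbit\<close>).

  For a free action, on a non-empty set, condition (i) holds and every orbit is in bijection
  with \<open>Q\<close>.
\<close>

section \<open>Conjugacy classes and the FC-centre\<close>

lemma (in group) conj_self_mem_conjugacy_class:
  assumes "x \<in> carrier G"
  shows "x \<in> conjugacy_class G x"
proof -
  have "x = \<one> \<otimes> x \<otimes> inv \<one>" using assms by simp
  then show ?thesis unfolding conjugacy_class_def by blast
qed

lemma (in group) conjugacy_class_one: "conjugacy_class G \<one> = {\<one>}"
proof -
  have "g \<otimes> \<one> \<otimes> inv g = \<one>" if "g \<in> carrier G" for g using that by simp
  then show ?thesis unfolding conjugacy_class_def by (auto intro!: exI[of _ \<one>])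
qed

lemma (in group) one_in_FC: "\<one> \<in> FC G"
  by (simp add: FC_def conjugacy_class_one)

lemma (in group) conjugate_in_FC:
  assumes x: "x \<in> FC G" and y: "y \<in> conjugacy_class G x"
  shows "y \<in> FC G"
proof -
  have xG: "x \<in> carrier G" using x by (simp add: FC_def)
  obtain g where g: "g \<in> carrier G" and y_eq: "y = g \<otimes> x \<otimes> inv g"
    using y by (auto simp: conjugacy_class_def)
  have "h \<otimes> y \<otimes> inv h = (h \<otimes> g) \<otimes> x \<otimes> inv (h \<otimes> g)" if "h \<in> carrier G" for h
    using that g xG by (simp add: y_eq inv_mult_group m_assoc)
  then have "conjugacy_class G y \<subseteq> conjugacy_class G x"
    using g by (fastforce simp: conjugacy_class_def)
  then show ?thesis
    using x g xG by (auto simp: FC_def y_eq intro: finite_subset)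
qed

text \<open>A class equal to \<open>{\<one>}\<close> is the class of \<open>\<one>\<close>, since each class contains its representative.\<close>

lemma (in group) icc_iff_FC:
  "icc G \<longleftrightarrow> carrier G \<noteq> {\<one>} \<and> FC G = {\<one>}"
proof -
  have "conjugacy_class G x = {\<one>} \<longleftrightarrow> x = \<one>" if "x \<in> carrier G" for x
    using conj_self_mem_conjugacy_class[OF that] conjugacy_class_one by auto
  then have "(\<forall>C \<in> conjugacy_class G ` carrier G. C \<noteq> {\<one>} \<longrightarrow> infinite C) \<longleftrightarrow> FC G \<subseteq> {\<one>}"
    by (auto simp: FC_def)
  then show ?thesis using one_in_FC by (auto simp: icc_def)
qed

lemma (in group) icc_infinite_carrier:
  assumes "icc G"
  shows "infinite (carrier G)"
proof
  assume fin: "finite (carrier G)"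
  have "conjugacy_class G x \<subseteq> carrier G" if "x \<in> carrier G" for x
    using that by (auto simp: conjugacy_class_def)
  then have "FC G = carrier G"
    using fin by (auto simp: FC_def intro: finite_subset)
  then show False using assms by (simp add: icc_iff_FC)
qed

section \<open>Conjugation in a wreath product\<close>

locale wreath = D: group D + group_action Q \<Omega> act
  for D :: "('d, 'a) monoid_scheme" and Q :: "('q, 'b) monoid_scheme"
    and \<Omega> :: "'x set" and act :: "'q \<Rightarrow> 'x \<Rightarrow> 'x"
begin

abbreviation "W \<equiv> wreath_product D Q \<Omega> act"

abbreviation "N \<equiv> restricted_power D \<Omega>"

sublocale Q: group Q
  using group_hom by (simp add: group_hom_def)

sublocale W: group W
  by (rule group_wreath_product) unfold_locales

lemma carrier_N: "carrier N = {\<phi> \<in> \<Omega> \<rightarrow>\<^sub>E carrier D. finite {x \<in> \<Omega>. \<phi> x \<noteq> \<one>\<^bsub>D\<^esub>}}"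
  by (rule carrier_restricted_power) unfold_locales

lemma N_extensional: "\<phi> \<in> carrier N \<Longrightarrow> \<phi> \<in> extensional \<Omega>"
  by (simp add: carrier_N PiE_def)

lemma N_value_closed [simp]: "\<phi> \<in> carrier N \<Longrightarrow> x \<in> \<Omega> \<Longrightarrow> \<phi> x \<in> carrier D"
  by (auto simp: carrier_N)

lemma act_closed [simp]: "p \<in> carrier Q \<Longrightarrow> x \<in> \<Omega> \<Longrightarrow> act p x \<in> \<Omega>"
  using element_image by blast

lemma act_one [simp]: "x \<in> \<Omega> \<Longrightarrow> act \<one>\<^bsub>Q\<^esub> x = x"
  using id_eq_one by (metis restrict_apply')

lemma act_inv_eq_iff:
  assumes "q \<in> carrier Q" "x \<in> \<Omega>"
  shows "act (inv\<^bsub>Q\<^esub> q) x = x \<longleftrightarrow> act q x = x"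
  using assms by (metis Q.inv_closed Q.inv_inv orbit_sym_aux)

lemma carrier_W [simp]: "(\<phi>, q) \<in> carrier W \<longleftrightarrow> \<phi> \<in> carrier N \<and> q \<in> carrier Q"
  by (simp add: wreath_product_def semidirect_product_def)

lemma one_W: "\<one>\<^bsub>W\<^esub> = (\<one>\<^bsub>N\<^esub>, \<one>\<^bsub>Q\<^esub>)"
  by (simp add: wreath_product_def semidirect_product_def)

lemma mult_W:
  assumes "\<psi> \<in> carrier N"
  shows "(\<phi>, p) \<otimes>\<^bsub>W\<^esub> (\<psi>, q)
    = ((\<lambda>x\<in>\<Omega>. \<phi> x \<otimes>\<^bsub>D\<^esub> \<psi> (act (inv\<^bsub>Q\<^esub> p) x)), p \<otimes>\<^bsub>Q\<^esub> q)"
  using assms by (auto simp: wreath_product_def semidirect_product_def shift_def)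

lemma N_eqI:
  assumes "\<phi> \<in> carrier N" "\<psi> \<in> carrier N" "\<And>x. x \<in> \<Omega> \<Longrightarrow> \<phi> x = \<psi> x"
  shows "\<phi> = \<psi>"
  using assms by (auto simp: carrier_N intro: PiE_ext)

lemma one_N: "\<one>\<^bsub>N\<^esub> = (\<lambda>x\<in>\<Omega>. \<one>\<^bsub>D\<^esub>)"
  by simp

lemma one_N_closed: "(\<lambda>x\<in>\<Omega>. \<one>\<^bsub>D\<^esub>) \<in> carrier N"
  by (auto simp: carrier_N)

text \<open>
  The conjugate is found by solving \<open>y \<cdot> (\<psi>, p) = (\<psi>, p) \<cdot> (\<phi>, q)\<close> for \<open>y\<close>, which avoids
  computing inverses in the semidirect product.
\<close>

lemma conj_W:
  assumes \<phi>: "\<phi> \<in> carrier N" and q: "q \<in> carrier Q"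
    and \<psi>: "\<psi> \<in> carrier N" and p: "p \<in> carrier Q"
  obtains \<phi>' where "\<phi>' \<in> carrier N"
    "(\<psi>, p) \<otimes>\<^bsub>W\<^esub> (\<phi>, q) \<otimes>\<^bsub>W\<^esub> inv\<^bsub>W\<^esub> (\<psi>, p) = (\<phi>', p \<otimes>\<^bsub>Q\<^esub> q \<otimes>\<^bsub>Q\<^esub> inv\<^bsub>Q\<^esub> p)"
    "\<And>x. x \<in> \<Omega> \<Longrightarrow> \<phi>' x = \<psi> x \<otimes>\<^bsub>D\<^esub> \<phi> (act (inv\<^bsub>Q\<^esub> p) x)
        \<otimes>\<^bsub>D\<^esub> inv\<^bsub>D\<^esub> \<psi> (act (inv\<^bsub>Q\<^esub> (p \<otimes>\<^bsub>Q\<^esub> q \<otimes>\<^bsub>Q\<^esub> inv\<^bsub>Q\<^esub> p)) x)"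
proof -
  let ?g = "(\<phi>, q)" and ?h = "(\<psi>, p)"
  let ?y = "?h \<otimes>\<^bsub>W\<^esub> ?g \<otimes>\<^bsub>W\<^esub> inv\<^bsub>W\<^esub> ?h"
  have g: "?g \<in> carrier W" and h: "?h \<in> carrier W" using assms by simp_all
  then have y: "?y \<in> carrier W" by blast
  obtain \<phi>' q' where y': "?y = (\<phi>', q')" by (cases ?y)
  with y have cl: "\<phi>' \<in> carrier N" "q' \<in> carrier Q" by (simp_all only: carrier_W)
  have "?y \<otimes>\<^bsub>W\<^esub> ?h = ?h \<otimes>\<^bsub>W\<^esub> ?g"
    using g h by (simp add: W.m_assoc del: carrier_W)
  then have "(\<phi>', q') \<otimes>\<^bsub>W\<^esub> ?h = ?h \<otimes>\<^bsub>W\<^esub> ?g"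
    unfolding y' .
  then have fst: "(\<lambda>x\<in>\<Omega>. \<phi>' x \<otimes>\<^bsub>D\<^esub> \<psi> (act (inv\<^bsub>Q\<^esub> q') x))
        = (\<lambda>x\<in>\<Omega>. \<psi> x \<otimes>\<^bsub>D\<^esub> \<phi> (act (inv\<^bsub>Q\<^esub> p) x))"
    and snd: "q' \<otimes>\<^bsub>Q\<^esub> p = p \<otimes>\<^bsub>Q\<^esub> q"
    using \<phi> \<psi> by (simp_all add: mult_W)
  from snd have q': "q' = p \<otimes>\<^bsub>Q\<^esub> q \<otimes>\<^bsub>Q\<^esub> inv\<^bsub>Q\<^esub> p"
    using q p cl by (metis Q.inv_solve_right Q.m_closed)
  have "\<phi>' x = \<psi> x \<otimes>\<^bsub>D\<^esub> \<phi> (act (inv\<^bsub>Q\<^esub> p) x) \<otimes>\<^bsub>D\<^esub> inv\<^bsub>D\<^esub> \<psi> (act (inv\<^bsub>Q\<^esub> q') x)"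
    if x: "x \<in> \<Omega>" for x
  proof -
    have "\<phi>' x \<otimes>\<^bsub>D\<^esub> \<psi> (act (inv\<^bsub>Q\<^esub> q') x) = \<psi> x \<otimes>\<^bsub>D\<^esub> \<phi> (act (inv\<^bsub>Q\<^esub> p) x)"
      using fun_cong[OF fst, of x] x by simp
    then show ?thesis
      using x \<phi> \<psi> p cl by (metis D.inv_solve_right D.m_closed N_value_closed Q.inv_closed act_closed)
  qed
  then show thesis using that[OF cl(1)] y' q' by simp
qed

text \<open>
  The projection to \<open>Q\<close> is surjective, so it maps a conjugacy class onto a conjugacy class.
\<close>

lemma FC_W_snd:
  assumes "(\<phi>, q) \<in> FC W"
  shows "q \<in> FC Q"
proof -
  have \<phi>: "\<phi> \<in> carrier N" and q: "q \<in> carrier Q" and fin: "finite (conjugacy_class W (\<phi>, q))"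
    using assms by (simp_all add: FC_def)
  have "conjugacy_class Q q \<subseteq> snd ` conjugacy_class W (\<phi>, q)"
  proof
    fix r assume "r \<in> conjugacy_class Q q"
    then obtain p where p: "p \<in> carrier Q" and r: "r = p \<otimes>\<^bsub>Q\<^esub> q \<otimes>\<^bsub>Q\<^esub> inv\<^bsub>Q\<^esub> p"
      by (auto simp: conjugacy_class_def)
    obtain \<phi>' where
      "(\<lambda>x\<in>\<Omega>. \<one>\<^bsub>D\<^esub>, p) \<otimes>\<^bsub>W\<^esub> (\<phi>, q) \<otimes>\<^bsub>W\<^esub> inv\<^bsub>W\<^esub> (\<lambda>x\<in>\<Omega>. \<one>\<^bsub>D\<^esub>, p) = (\<phi>', r)"
      using conj_W[OF \<phi> q one_N_closed p] r by metis
    then have "(\<phi>', r) \<in> conjugacy_class W (\<phi>, q)"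
      unfolding conjugacy_class_def using p one_N_closed
      by (metis (mono_tags, lifting) carrier_W mem_Collect_eq)
    then show "r \<in> snd ` conjugacy_class W (\<phi>, q)" by force
  qed
  then show ?thesis
    using fin q by (auto simp: FC_def intro: finite_subset)
qed

section \<open>Elements with a finite conjugacy class\<close>

text \<open>
  All conjugates \<open>r\<close> of \<open>q\<close> fix \<open>\<Omega>\<close> pointwise too, so in the conjugation formula the two factors
  coming from \<open>\<psi>\<close> are evaluated at the same point and cancel.
\<close>

lemma pointwise_fixing_FC:
  assumes q: "q \<in> FC Q" and fixes_all: "\<And>x. x \<in> \<Omega> \<Longrightarrow> act q x = x"
  shows "(\<one>\<^bsub>N\<^esub>, q) \<in> FC W"
proof -
  have qQ: "q \<in> carrier Q" and fin: "finite (conjugacy_class Q q)"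
    using q by (simp_all add: FC_def)
  have "conjugacy_class W (\<one>\<^bsub>N\<^esub>, q) \<subseteq> {\<one>\<^bsub>N\<^esub>} \<times> conjugacy_class Q q"
  proof
    fix y assume "y \<in> conjugacy_class W (\<one>\<^bsub>N\<^esub>, q)"
    then obtain \<psi> p where \<psi>: "\<psi> \<in> carrier N" and p: "p \<in> carrier Q"
      and y: "y = (\<psi>, p) \<otimes>\<^bsub>W\<^esub> (\<one>\<^bsub>N\<^esub>, q) \<otimes>\<^bsub>W\<^esub> inv\<^bsub>W\<^esub> (\<psi>, p)"
      unfolding conjugacy_class_def by (auto simp del: one_sum_group)
    let ?r = "p \<otimes>\<^bsub>Q\<^esub> q \<otimes>\<^bsub>Q\<^esub> inv\<^bsub>Q\<^esub> p"
    obtain \<phi>' where \<phi>': "\<phi>' \<in> carrier N" and y': "y = (\<phi>', ?r)"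
      and val: "\<And>x. x \<in> \<Omega> \<Longrightarrow> \<phi>' x = \<psi> x \<otimes>\<^bsub>D\<^esub> \<one>\<^bsub>N\<^esub> (act (inv\<^bsub>Q\<^esub> p) x)
        \<otimes>\<^bsub>D\<^esub> inv\<^bsub>D\<^esub> \<psi> (act (inv\<^bsub>Q\<^esub> ?r) x)"
      using conj_W[OF _ qQ \<psi> p, of "\<one>\<^bsub>N\<^esub>"] one_N_closed y one_N by metis
    have "act ?r x = x" if "x \<in> \<Omega>" for x
    proof -
      have "act ?r x = act p (act q (act (inv\<^bsub>Q\<^esub> p) x))"
        using that p qQ by (simp add: composition_rule)
      also have "\<dots> = act p (act (inv\<^bsub>Q\<^esub> p) x)"
        using that p fixes_all by simp
      also have "\<dots> = x"
        using that p by (metis Q.inv_closed Q.r_inv act_one composition_rule)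
      finally show ?thesis .
    qed
    then have "\<phi>' x = \<one>\<^bsub>D\<^esub>" if "x \<in> \<Omega>" for x
      using val[OF that] that p qQ \<psi> act_inv_eq_iff[of ?r x]
      by (simp del: Q.inv_mult_group)
    then have "\<phi>' = \<one>\<^bsub>N\<^esub>"
      by (intro N_eqI \<phi>') (use one_N_closed in auto)
    then show "y \<in> {\<one>\<^bsub>N\<^esub>} \<times> conjugacy_class Q q"
      using y' p by (auto simp: conjugacy_class_def)
  qed
  then have "finite (conjugacy_class W (\<one>\<^bsub>N\<^esub>, q))"
    by (rule finite_subset) (simp add: fin)
  then show ?thesis using qQ one_N_closed by (simp add: FC_def)
qed

text \<open>
  The function is invariant under \<open>Q\<close>, so its conjugates in \<open>W\<close> are its conjugates under the base
  group: they are trivial off the orbit and take values in the finite class of \<open>d\<close> on it.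
\<close>

lemma constant_on_finite_orbit_FC:
  assumes d: "d \<in> FC D" and orb: "orb \<in> orbits Q \<Omega> act" "finite orb"
  shows "((\<lambda>x\<in>\<Omega>. if x \<in> orb then d else \<one>\<^bsub>D\<^esub>), \<one>\<^bsub>Q\<^esub>) \<in> FC W"
proof -
  let ?\<phi> = "\<lambda>x\<in>\<Omega>. if x \<in> orb then d else \<one>\<^bsub>D\<^esub>"
  have dD: "d \<in> carrier D" and fin: "finite (conjugacy_class D d)"
    using d by (simp_all add: FC_def)
  obtain x0 where x0: "x0 \<in> \<Omega>" and orb_eq: "orb = {act g x0 | g. g \<in> carrier Q}"
    using orb(1) by (auto simp: orbits_def orbit_def)
  have orb_sub: "orb \<subseteq> \<Omega>" using orb_eq x0 by auto
  have inv1: "act p x \<in> orb" if "p \<in> carrier Q" "x \<in> orb" for p x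
    using that x0 unfolding orb_eq by (auto simp: composition_rule[symmetric])
  have inv: "act p x \<in> orb \<longleftrightarrow> x \<in> orb" if "p \<in> carrier Q" "x \<in> \<Omega>" for p x
    using that inv1[of p x] inv1[of "inv\<^bsub>Q\<^esub> p" "act p x"]
    by (metis Q.inv_closed orbit_sym_aux)
  have "finite {x \<in> \<Omega>. ?\<phi> x \<noteq> \<one>\<^bsub>D\<^esub>}"
    by (rule finite_subset[OF _ orb(2)]) auto
  then have \<phi>: "?\<phi> \<in> carrier N"
    using dD by (auto simp: carrier_N)
  \<comment> \<open>a finite set containing the base components of all conjugates\<close>
  let ?F = "(\<lambda>f. \<lambda>x\<in>\<Omega>. if x \<in> orb then f x else \<one>\<^bsub>D\<^esub>) ` (orb \<rightarrow>\<^sub>E conjugacy_class D d)"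
  have "conjugacy_class W (?\<phi>, \<one>\<^bsub>Q\<^esub>) \<subseteq> ?F \<times> {\<one>\<^bsub>Q\<^esub>}"
  proof
    fix y assume "y \<in> conjugacy_class W (?\<phi>, \<one>\<^bsub>Q\<^esub>)"
    then obtain \<psi> p where \<psi>: "\<psi> \<in> carrier N" and p: "p \<in> carrier Q"
      and y: "y = (\<psi>, p) \<otimes>\<^bsub>W\<^esub> (?\<phi>, \<one>\<^bsub>Q\<^esub>) \<otimes>\<^bsub>W\<^esub> inv\<^bsub>W\<^esub> (\<psi>, p)"
      unfolding conjugacy_class_def by auto
    obtain \<phi>' where \<phi>': "\<phi>' \<in> carrier N" and y': "y = (\<phi>', \<one>\<^bsub>Q\<^esub>)"
      and val: "\<And>x. x \<in> \<Omega> \<Longrightarrow> \<phi>' x = \<psi> x \<otimes>\<^bsub>D\<^esub> ?\<phi> (act (inv\<^bsub>Q\<^esub> p) x) \<otimes>\<^bsub>D\<^esub> inv\<^bsub>D\<^esub> \<psi> x"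
      using conj_W[OF \<phi> Q.one_closed \<psi> p] y p by (simp del: restrict_apply) metis
    have on: "\<phi>' x = \<psi> x \<otimes>\<^bsub>D\<^esub> d \<otimes>\<^bsub>D\<^esub> inv\<^bsub>D\<^esub> \<psi> x" if "x \<in> orb" for x
      using val[of x] that orb_sub p inv by auto
    have off: "\<phi>' x = \<one>\<^bsub>D\<^esub>" if "x \<in> \<Omega>" "x \<notin> orb" for x
      using val[of x] that p inv \<psi> by auto
    have ext: "\<phi>' \<in> extensional \<Omega>"
      by (rule N_extensional[OF \<phi>'])
    have "restrict \<phi>' orb \<in> orb \<rightarrow>\<^sub>E conjugacy_class D d"
      using on orb_sub \<psi> unfolding conjugacy_class_def by (auto intro: N_value_closed)
    moreover have "\<phi>' = (\<lambda>x\<in>\<Omega>. if x \<in> orb then restrict \<phi>' orb x else \<one>\<^bsub>D\<^esub>)"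
    proof
      fix x
      show "\<phi>' x = (\<lambda>x\<in>\<Omega>. if x \<in> orb then restrict \<phi>' orb x else \<one>\<^bsub>D\<^esub>) x"
        using off[of x] extensional_arb[OF ext, of x] by simp
    qed
    ultimately show "y \<in> ?F \<times> {\<one>\<^bsub>Q\<^esub>}" using y' by blast
  qed
  moreover have "finite (?F \<times> {\<one>\<^bsub>Q\<^esub>})"
    by (intro finite_cartesian_product finite_imageI finite_PiE) (use orb(2) fin in auto)
  ultimately have "finite (conjugacy_class W (?\<phi>, \<one>\<^bsub>Q\<^esub>))"
    by (rule finite_subset)
  then show ?thesis using \<phi> by (simp add: FC_def)
qed

section \<open>Constraints on a finite conjugacy class\<close>

definition bump :: "'x \<Rightarrow> 'd \<Rightarrow> 'x \<Rightarrow> 'd" where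
  "bump x d = (\<lambda>y\<in>\<Omega>. if y = x then d else \<one>\<^bsub>D\<^esub>)"

lemma bump_closed:
  assumes "d \<in> carrier D"
  shows "bump x d \<in> carrier N"
proof -
  have "finite {y \<in> \<Omega>. bump x d y \<noteq> \<one>\<^bsub>D\<^esub>}"
    by (rule finite_subset[of _ "{x}"]) (auto simp: bump_def)
  then show ?thesis using assms by (auto simp: carrier_N bump_def)
qed

text \<open>
  If \<open>q\<close> moves \<open>x\<close>, the bump translated by \<open>q\<close> is supported away from \<open>x\<close>, so only the left factor
  of the conjugation is seen at \<open>x\<close>.
\<close>

lemma conj_by_bump:
  assumes g: "(\<phi>, q) \<in> carrier W" and d: "d \<in> carrier D" and x: "x \<in> \<Omega>"
  obtains \<phi>' where "(\<phi>', q) \<in> conjugacy_class W (\<phi>, q)"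
    and "\<phi>' x = (if act q x = x then d \<otimes>\<^bsub>D\<^esub> \<phi> x \<otimes>\<^bsub>D\<^esub> inv\<^bsub>D\<^esub> d else d \<otimes>\<^bsub>D\<^esub> \<phi> x)"
proof -
  have \<phi>: "\<phi> \<in> carrier N" and q: "q \<in> carrier Q" using g by simp_all
  obtain \<phi>' where
    "(bump x d, \<one>\<^bsub>Q\<^esub>) \<otimes>\<^bsub>W\<^esub> (\<phi>, q) \<otimes>\<^bsub>W\<^esub> inv\<^bsub>W\<^esub> (bump x d, \<one>\<^bsub>Q\<^esub>) = (\<phi>', q)"
    and val: "\<And>y. y \<in> \<Omega> \<Longrightarrow> \<phi>' y = bump x d y \<otimes>\<^bsub>D\<^esub> \<phi> y \<otimes>\<^bsub>D\<^esub> inv\<^bsub>D\<^esub> bump x d (act (inv\<^bsub>Q\<^esub> q) y)"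
    using conj_W[OF \<phi> q bump_closed[OF d] Q.one_closed] q by simp metis
  then have "(\<phi>', q) \<in> conjugacy_class W (\<phi>, q)"
    unfolding conjugacy_class_def using bump_closed[OF d]
    by (metis (mono_tags, lifting) Q.one_closed carrier_W mem_Collect_eq)
  moreover have "\<phi>' x = (if act q x = x then d \<otimes>\<^bsub>D\<^esub> \<phi> x \<otimes>\<^bsub>D\<^esub> inv\<^bsub>D\<^esub> d else d \<otimes>\<^bsub>D\<^esub> \<phi> x)"
    using val[OF x] x q d \<phi> by (simp add: bump_def act_inv_eq_iff)
  ultimately show thesis by (rule that)
qed

lemma finite_values_of_FC:
  assumes "(\<phi>, q) \<in> FC W"
  shows "finite ((\<lambda>g. fst g x) ` conjugacy_class W (\<phi>, q))"
  using assms by (simp add: FC_def)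

text \<open>
  Otherwise the values at \<open>x\<close> over the conjugacy class would fill the whole coset \<open>D \<cdot> \<phi> x = D\<close>.
\<close>

lemma FC_W_fixes_if_D_infinite:
  assumes g: "(\<phi>, q) \<in> FC W" and inf: "infinite (carrier D)" and x: "x \<in> \<Omega>"
  shows "act q x = x"
proof (rule ccontr)
  assume moved: "act q x \<noteq> x"
  have gW: "(\<phi>, q) \<in> carrier W" using g by (simp add: FC_def)
  then have \<phi>x: "\<phi> x \<in> carrier D" using x by simp
  have "(\<lambda>d. d \<otimes>\<^bsub>D\<^esub> \<phi> x) ` carrier D \<subseteq> (\<lambda>g. fst g x) ` conjugacy_class W (\<phi>, q)"
  proof safe
    fix d assume "d \<in> carrier D"
    then obtain \<phi>' where "(\<phi>', q) \<in> conjugacy_class W (\<phi>, q)" "\<phi>' x = d \<otimes>\<^bsub>D\<^esub> \<phi> x"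
      using conj_by_bump[OF gW _ x] moved by metis
    then show "d \<otimes>\<^bsub>D\<^esub> \<phi> x \<in> (\<lambda>g. fst g x) ` conjugacy_class W (\<phi>, q)" by force
  qed
  then have "finite ((\<lambda>d. d \<otimes>\<^bsub>D\<^esub> \<phi> x) ` carrier D)"
    using finite_values_of_FC[OF g] by (rule finite_subset)
  moreover have "inj_on (\<lambda>d. d \<otimes>\<^bsub>D\<^esub> \<phi> x) (carrier D)"
    using \<phi>x by (auto simp: inj_on_def)
  ultimately show False using inf by (auto dest: finite_imageD)
qed

lemma FC_W_value_in_FC_D:
  assumes g: "(\<phi>, q) \<in> FC W" and x: "x \<in> \<Omega>" "act q x = x"
  shows "\<phi> x \<in> FC D"
proof -
  have gW: "(\<phi>, q) \<in> carrier W" using g by (simp add: FC_def)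
  have "conjugacy_class D (\<phi> x) \<subseteq> (\<lambda>g. fst g x) ` conjugacy_class W (\<phi>, q)"
  proof
    fix c assume "c \<in> conjugacy_class D (\<phi> x)"
    then obtain d where d: "d \<in> carrier D" "c = d \<otimes>\<^bsub>D\<^esub> \<phi> x \<otimes>\<^bsub>D\<^esub> inv\<^bsub>D\<^esub> d"
      by (auto simp: conjugacy_class_def)
    then obtain \<phi>' where "(\<phi>', q) \<in> conjugacy_class W (\<phi>, q)" "\<phi>' x = c"
      using conj_by_bump[OF gW _ x(1)] x(2) by metis
    then show "c \<in> (\<lambda>g. fst g x) ` conjugacy_class W (\<phi>, q)" by force
  qed
  then have "finite (conjugacy_class D (\<phi> x))"
    using finite_values_of_FC[OF g] by (rule finite_subset)
  then show ?thesis using gW x(1) by (simp add: FC_def)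
qed

text \<open>
  Conjugating by \<open>p\<close> moves the value at \<open>x\<close> to \<open>p x\<close>. If it were non-trivial, the whole orbit of
  \<open>x\<close> would lie in the union of the supports over the conjugacy class, which is a finite union of
  finite sets.
\<close>

lemma FC_W_trivial_on_infinite_orbit:
  assumes g: "(\<phi>, q) \<in> FC W" and x: "x \<in> \<Omega>" and inf: "infinite (orbit Q act x)"
  shows "\<phi> x = \<one>\<^bsub>D\<^esub>"
proof (rule ccontr)
  assume ne: "\<phi> x \<noteq> \<one>\<^bsub>D\<^esub>"
  have \<phi>: "\<phi> \<in> carrier N" and q: "q \<in> carrier Q" and fin: "finite (conjugacy_class W (\<phi>, q))"
    using g by (simp_all add: FC_def)
  let ?S = "\<Union>g \<in> conjugacy_class W (\<phi>, q). {y \<in> \<Omega>. fst g y \<noteq> \<one>\<^bsub>D\<^esub>}"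
  have "conjugacy_class W (\<phi>, q) \<subseteq> carrier W"
    using \<phi> q by (auto simp: conjugacy_class_def)
  then have "finite {y \<in> \<Omega>. fst g y \<noteq> \<one>\<^bsub>D\<^esub>}" if "g \<in> conjugacy_class W (\<phi>, q)" for g
    using that by (cases g) (auto simp: carrier_N)
  then have "finite ?S" using fin by blast
  moreover have "orbit Q act x \<subseteq> ?S"
  proof
    fix y assume "y \<in> orbit Q act x"
    then obtain p where p: "p \<in> carrier Q" and y: "y = act p x" by (auto simp: orbit_def)
    let ?r = "p \<otimes>\<^bsub>Q\<^esub> q \<otimes>\<^bsub>Q\<^esub> inv\<^bsub>Q\<^esub> p" and ?e = "\<lambda>x\<in>\<Omega>. \<one>\<^bsub>D\<^esub>"
    have y_in: "y \<in> \<Omega>" and turned_back: "act (inv\<^bsub>Q\<^esub> p) y = x"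
      using p x y orbit_sym_aux by auto
    obtain \<phi>' where eq: "(?e, p) \<otimes>\<^bsub>W\<^esub> (\<phi>, q) \<otimes>\<^bsub>W\<^esub> inv\<^bsub>W\<^esub> (?e, p) = (\<phi>', ?r)"
      and val: "\<And>z. z \<in> \<Omega> \<Longrightarrow> \<phi>' z = ?e z \<otimes>\<^bsub>D\<^esub> \<phi> (act (inv\<^bsub>Q\<^esub> p) z)
          \<otimes>\<^bsub>D\<^esub> inv\<^bsub>D\<^esub> ?e (act (inv\<^bsub>Q\<^esub> ?r) z)"
      using conj_W[OF \<phi> q one_N_closed p] by metis
    have "(\<phi>', ?r) \<in> conjugacy_class W (\<phi>, q)"
      unfolding conjugacy_class_def using p one_N_closed eq[symmetric]
      by (metis (mono_tags, lifting) carrier_W mem_Collect_eq)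
    moreover have "\<phi>' y = \<phi> x"
      using val[OF y_in] y_in turned_back p q x \<phi> by simp
    ultimately show "y \<in> ?S" using ne y_in by force
  qed
  ultimately show False using inf finite_subset by blast
qed

text \<open>
  The preceding lemma applies to every conjugate of \<open>(\<phi>, q)\<close>; if \<open>q\<close> moved \<open>x\<close>, conjugating by a
  bump would produce one with a non-trivial value at \<open>x\<close>.
\<close>

lemma FC_W_fixes_infinite_orbit:
  assumes g: "(\<phi>, q) \<in> FC W" and nontriv: "carrier D \<noteq> {\<one>\<^bsub>D\<^esub>}"
    and x: "x \<in> \<Omega>" and inf: "infinite (orbit Q act x)"
  shows "act q x = x"
proof (rule ccontr)
  assume moved: "act q x \<noteq> x"
  have gW: "(\<phi>, q) \<in> carrier W" using g by (simp add: FC_def)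
  obtain d where d: "d \<in> carrier D" "d \<noteq> \<one>\<^bsub>D\<^esub>"
    using nontriv D.one_closed by blast
  obtain \<phi>' where mem: "(\<phi>', q) \<in> conjugacy_class W (\<phi>, q)" and "\<phi>' x = d \<otimes>\<^bsub>D\<^esub> \<phi> x"
    using conj_by_bump[OF gW d(1) x] moved by metis
  then have "\<phi>' x \<noteq> \<one>\<^bsub>D\<^esub>"
    using FC_W_trivial_on_infinite_orbit[OF g x inf] d by simp
  moreover have "(\<phi>', q) \<in> FC W"
    by (rule W.conjugate_in_FC[OF g mem])
  ultimately show False
    using FC_W_trivial_on_infinite_orbit[OF _ x inf] by blast
qed

lemma FC_W_trivial:
  assumes nontriv: "carrier D \<noteq> {\<one>\<^bsub>D\<^esub>}"
    and i: "{q \<in> FC Q. \<forall>x \<in> \<Omega>. act q x = x} = {\<one>\<^bsub>Q\<^esub>}"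
    and ii_iii: "icc D \<or> (\<forall>orb \<in> orbits Q \<Omega> act. infinite orb)"
    and g: "(\<phi>, q) \<in> FC W"
  shows "(\<phi>, q) = \<one>\<^bsub>W\<^esub>"
proof -
  have \<phi>: "\<phi> \<in> carrier N" using g by (simp add: FC_def)
  have "act q x = x \<and> \<phi> x = \<one>\<^bsub>D\<^esub>" if x: "x \<in> \<Omega>" for x
    using ii_iii
  proof
    assume ii: "icc D"
    then have "FC D = {\<one>\<^bsub>D\<^esub>}" by (simp add: D.icc_iff_FC)
    with ii show ?thesis
      using FC_W_fixes_if_D_infinite[OF g D.icc_infinite_carrier x] FC_W_value_in_FC_D[OF g x]
      by blast
  next
    assume "\<forall>orb \<in> orbits Q \<Omega> act. infinite orb"
    then have "infinite (orbit Q act x)" using x by (auto simp: orbits_def)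
    then show ?thesis
      using FC_W_fixes_infinite_orbit[OF g nontriv x] FC_W_trivial_on_infinite_orbit[OF g x]
      by blast
  qed
  then have fixes_all: "\<forall>x\<in>\<Omega>. act q x = x" and triv: "\<And>x. x \<in> \<Omega> \<Longrightarrow> \<phi> x = \<one>\<^bsub>D\<^esub>"
    by blast+
  from fixes_all have "q = \<one>\<^bsub>Q\<^esub>"
    using i FC_W_snd[OF g] by blast
  moreover have "\<phi> = \<one>\<^bsub>N\<^esub>"
    by (rule N_eqI[OF \<phi>]) (use one_N_closed triv in auto)
  ultimately show ?thesis by (simp add: one_W)
qed

text \<open>
  The hypothesis on \<open>\<Omega>\<close> and \<open>Q\<close> excludes the case in which \<open>W\<close> is trivial even though
  condition (i) holds and condition (iii) holds vacuously.
\<close>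

lemma W_nontrivial:
  assumes "carrier D \<noteq> {\<one>\<^bsub>D\<^esub>}" and "\<Omega> \<noteq> {} \<or> carrier Q \<noteq> {\<one>\<^bsub>Q\<^esub>}"
  shows "carrier W \<noteq> {\<one>\<^bsub>W\<^esub>}"
  using assms(2)
proof
  assume "\<Omega> \<noteq> {}"
  then obtain x where x: "x \<in> \<Omega>" by blast
  obtain d where d: "d \<in> carrier D" "d \<noteq> \<one>\<^bsub>D\<^esub>"
    using assms(1) D.one_closed by blast
  have "bump x d x \<noteq> \<one>\<^bsub>N\<^esub> x" using x d by (simp add: bump_def)
  then have "bump x d \<noteq> \<one>\<^bsub>N\<^esub>" by metis
  moreover have "(bump x d, \<one>\<^bsub>Q\<^esub>) \<in> carrier W" using bump_closed d by simp
  ultimately show ?thesis unfolding one_W by blast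
next
  assume "carrier Q \<noteq> {\<one>\<^bsub>Q\<^esub>}"
  then obtain q where "q \<in> carrier Q" "q \<noteq> \<one>\<^bsub>Q\<^esub>" using Q.one_closed by blast
  moreover from this have "(\<one>\<^bsub>N\<^esub>, q) \<in> carrier W" using one_N_closed by simp
  ultimately show ?thesis unfolding one_W by blast
qed

theorem icc_W_iff:
  assumes nontriv: "carrier D \<noteq> {\<one>\<^bsub>D\<^esub>}" and "\<Omega> \<noteq> {} \<or> carrier Q \<noteq> {\<one>\<^bsub>Q\<^esub>}"
  shows "icc W \<longleftrightarrow> {q \<in> FC Q. \<forall>x \<in> \<Omega>. act q x = x} = {\<one>\<^bsub>Q\<^esub>} \<and>
    (icc D \<or> (\<forall>orb \<in> orbits Q \<Omega> act. infinite orb))"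
    (is "_ \<longleftrightarrow> ?i \<and> (_ \<or> ?iii)")
proof (intro iffI conjI)
  assume "icc W"
  then have FC_W: "FC W = {\<one>\<^bsub>W\<^esub>}" by (simp add: W.icc_iff_FC)
  have "q = \<one>\<^bsub>Q\<^esub>" if "q \<in> FC Q" "\<forall>x \<in> \<Omega>. act q x = x" for q
  proof -
    have "(\<one>\<^bsub>N\<^esub>, q) \<in> FC W" using pointwise_fixing_FC that by blast
    then show ?thesis unfolding FC_W one_W by blast
  qed
  moreover have "\<one>\<^bsub>Q\<^esub> \<in> {q \<in> FC Q. \<forall>x \<in> \<Omega>. act q x = x}"
    using Q.one_in_FC by simp
  ultimately show ?i by blast
  show "icc D \<or> ?iii"
  proof (rule ccontr)
    assume neg: "\<not> (icc D \<or> ?iii)"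
    then obtain orb where orb: "orb \<in> orbits Q \<Omega> act" "finite orb" by blast
    obtain d where d: "d \<in> FC D" "d \<noteq> \<one>\<^bsub>D\<^esub>"
      using neg nontriv D.one_in_FC by (auto simp: D.icc_iff_FC)
    obtain x where x: "x \<in> \<Omega>" "x \<in> orb"
      using orb(1) orbit_refl by (auto simp: orbits_def)
    have "(\<lambda>x\<in>\<Omega>. if x \<in> orb then d else \<one>\<^bsub>D\<^esub>) = \<one>\<^bsub>N\<^esub>"
      using constant_on_finite_orbit_FC[OF d(1) orb] FC_W by (simp add: one_W del: one_sum_group)
    from fun_cong[OF this, of x] show False using x d(2) by simp
  qed
next
  assume "?i \<and> (icc D \<or> ?iii)"
  then have "FC W \<subseteq> {\<one>\<^bsub>W\<^esub>}" using FC_W_trivial[OF nontriv] by auto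
  then have "FC W = {\<one>\<^bsub>W\<^esub>}" using W.one_in_FC by blast
  then show "icc W" using W_nontrivial[OF assms] by (simp add: W.icc_iff_FC)
qed

section \<open>Free actions\<close>

lemma free_action_infinite_orbit_iff:
  assumes free: "free_action Q \<Omega> act" and x: "x \<in> \<Omega>"
  shows "infinite (orbit Q act x) \<longleftrightarrow> infinite (carrier Q)"
proof -
  have "inj_on (\<lambda>g. act g x) (carrier Q)"
  proof (rule inj_onI)
    fix g h assume gh: "g \<in> carrier Q" "h \<in> carrier Q" "act g x = act h x"
    then have "act (inv\<^bsub>Q\<^esub> h \<otimes>\<^bsub>Q\<^esub> g) x = x"
      using x by (simp add: composition_rule) (metis orbit_sym_aux)
    then have "inv\<^bsub>Q\<^esub> h \<otimes>\<^bsub>Q\<^esub> g = \<one>\<^bsub>Q\<^esub>"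
      using free x gh unfolding free_action_def by blast
    then show "g = h" using gh by (metis Q.inv_closed Q.inv_equality Q.inv_inv)
  qed
  moreover have "orbit Q act x = (\<lambda>g. act g x) ` carrier Q"
    by (auto simp: orbit_def)
  ultimately show ?thesis by (simp add: finite_image_iff)
qed

theorem icc_W_iff_free:
  assumes nontriv: "carrier D \<noteq> {\<one>\<^bsub>D\<^esub>}" and ne: "\<Omega> \<noteq> {}" and free: "free_action Q \<Omega> act"
  shows "icc W \<longleftrightarrow> icc D \<or> infinite (carrier Q)"
proof -
  have "{q \<in> FC Q. \<forall>x \<in> \<Omega>. act q x = x} = {\<one>\<^bsub>Q\<^esub>}"
    using free ne Q.one_in_FC by (auto simp: free_action_def FC_def)
  moreover have "(\<forall>orb \<in> orbits Q \<Omega> act. infinite orb) \<longleftrightarrow> infinite (carrier Q)"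
    using ne free_action_infinite_orbit_iff[OF free] by (auto simp: orbits_def)
  ultimately show ?thesis using icc_W_iff nontriv ne by simp
qed

end

theorem theorem1:
  fixes D :: "('d, 'a) monoid_scheme" and Q :: "('q, 'b) monoid_scheme"
    and \<Omega> :: "'x set" and act :: "'q \<Rightarrow> 'x \<Rightarrow> 'x"
  assumes "group D" and "group Q" and "carrier D \<noteq> {\<one>\<^bsub>D\<^esub>}"
    and "group_action Q \<Omega> act"
    and "\<Omega> \<noteq> {} \<or> carrier Q \<noteq> {\<one>\<^bsub>Q\<^esub>}"
  shows "(icc (wreath_product D Q \<Omega> act) \<longleftrightarrow>
            {q \<in> FC Q. \<forall>x \<in> \<Omega>. act q x = x} = {\<one>\<^bsub>Q\<^esub>} \<and>
            (icc D \<or> (\<forall>orb \<in> orbits Q \<Omega> act. infinite orb))) \<and>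
         (\<Omega> \<noteq> {} \<longrightarrow> free_action Q \<Omega> act \<longrightarrow>
            (icc (wreath_product D Q \<Omega> act) \<longleftrightarrow> icc D \<or> infinite (carrier Q)))"
proof -
  interpret wreath D Q \<Omega> act using assms by (simp add: wreath_def)
  show ?thesis using icc_W_iff icc_W_iff_free assms by blast
qed

end
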